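(* Let $n$ be an odd positive integer, let $H = \{x\in\mathbb{R}^n : 2\sum_{i=1}^n x_i \le n\}$, and let $C = H\cap[0,1]^n$. Consider the pure integer problem $\max\{\sum_{i=1}^n x_i : x\in C\cap\mathbb{Z}^n\}$. Its optimal value is $\lfloor n/2\rfloor$, and, for every integer $s$ with $1\le s\le\lfloor n/2\rfloor$, any branch-and-bound proof based on split disjunctions of sparsity at most $s$ that certifies $\sum_{i=1}^n x_i\le\lfloor n/2\rfloor$ has size at least $\Omega\left(\sqrt{\frac{n(n-s)}{s}}\right)$ (i.e., size at least $\kappa\sqrt{n(n-s)/s}$ for an absolute constant $\kappa>0$).
   Context: A split disjunction in $\mathbb{R}^n$ (with respect to $\mathbb{Z}^n$) is a union $\{x : \langle\pi,x\rangle\le\pi_0\}\cup\{x:\langle\pi,x\rangle\ge\pi_0+1\}$ with $\pi\in\mathbb{Z}^n$, $\pi_0\in\mathbb{Z}$. It has sparsity at most $s$ if the inequalities describing its two halfspaces have at most $s$ non-zero coefficients, i.e., $\pi$ has at most $s$ non-zero entries. A branch-and-bound proof (based on a family of disjunctions $Q_1\cup\dots\cup Q_k\supseteq\mathbb{Z}^n$) is a finite rooted tree whose nodes are convex subsets of $C$: the root is $C$, and each non-leaf node $N$ has as children the sets $Q_1\cap N,\dots,Q_k\cap N$ for some disjunction $Q_1\cup\dots\cup Q_k$ in the family. It certifies (proves the validity of) an inequality $\langle c,x\rangle\le\gamma$ if this inequality is valid for every leaf (empty leaves satisfy this vacuously). It is not required that the disjunction applied at a node cut off an optimal solution of the relaxation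 at that node. The size of the proof is the total number of nodes of the tree. *)

theory Defs
  imports Complex_Main "Jordan_Normal_Form.Matrix"
begin

text \<open>
  Since the constant in the lower bound is independent of the dimension, \<open>n\<close> has to be
  quantified inside the statement. Hence \<open>\<real>\<^sup>n\<close> is \<open>carrier_vec n :: real vec set\<close>,
  with coordinates indexed by \<open>{..<n}\<close>.
\<close>

definition int_points :: "nat \<Rightarrow> real vec set" where
  "int_points n = {x \<in> carrier_vec n. \<forall>i<n. x $ i \<in> \<int>}"

definition real_vec :: "int vec \<Rightarrow> real vec" where
  "real_vec p = map_vec real_of_int p"

text \<open>A disjunction \<open>Q\<^sub>1 \<union> \<dots> \<union> Q\<^sub>k\<close> is represented by the list of its terms.\<close>

definition split_disj :: "nat \<Rightarrow> int vec \<Rightarrow> int \<Rightarrow> real vec set list" where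
  "split_disj n p p0 =
     [{x \<in> carrier_vec n. real_vec p \<bullet> x \<le> real_of_int p0},
      {x \<in> carrier_vec n. real_vec p \<bullet> x \<ge> real_of_int p0 + 1}]"

definition sparse_splits :: "nat \<Rightarrow> nat \<Rightarrow> real vec set list set" where
  "sparse_splits n s =
     {split_disj n p p0 | p p0. p \<in> carrier_vec n \<and> card {i. i < n \<and> p $ i \<noteq> 0} \<le> s}"

lemma sparse_splits_cover:
  assumes "Qs \<in> sparse_splits n s"
  shows "int_points n \<subseteq> \<Union> (set Qs)"
proof
  fix x assume x: "x \<in> int_points n"
  obtain p p0 where p: "p \<in> carrier_vec n" and Qs: "Qs = split_disj n p p0"
    using assms by (auto simp: sparse_splits_def)
  have "real_vec p \<bullet> x \<in> \<int>"
    using x p by (auto simp: scalar_prod_def int_points_def real_vec_def intro!: Ints_sum Ints_mult)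
  then obtain k where k: "real_vec p \<bullet> x = real_of_int k"
    by (elim Ints_cases)
  have "k \<le> p0 \<or> k \<ge> p0 + 1" by linarith
  then have "real_vec p \<bullet> x \<le> real_of_int p0 \<or> real_vec p \<bullet> x \<ge> real_of_int p0 + 1"
    unfolding k by linarith
  then show "x \<in> \<Union> (set Qs)"
    using x by (auto simp: Qs split_disj_def int_points_def)
qed

text \<open>
  Each node carries its set; a leaf is a node with an empty list of children. Distinct nodes may
  carry the same set (for instance the empty set), and each of them is counted in the size.
\<close>

datatype bb_tree = Node (node_set: "real vec set") (children: "bb_tree list")

primrec num_nodes :: "bb_tree \<Rightarrow> nat" where
  "num_nodes (Node N ts) = 1 + sum_list (map num_nodes ts)"

primrec leaf_sets :: "bb_tree \<Rightarrow> real vec set set" where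
  "leaf_sets (Node N ts) = (if ts = [] then {N} else \<Union> (set (map leaf_sets ts)))"

text \<open>
  Every non-leaf node is branched on by some member of the family \<open>F\<close>. For families of split
  disjunctions and a convex root, all nodes are automatically convex subsets of the root.
\<close>

inductive branching :: "real vec set list set \<Rightarrow> bb_tree \<Rightarrow> bool"
  for F :: "real vec set list set" where
  leaf: "branching F (Node N [])"
| branch: "branching F (Node N ts)"
    if "Qs \<in> F" "map node_set ts = map (\<lambda>Q. Q \<inter> N) Qs" "\<forall>t \<in> set ts. branching F t"

definition bb_proof :: "real vec set list set \<Rightarrow> real vec set \<Rightarrow> bb_tree \<Rightarrow> bool" where
  "bb_proof F C t \<longleftrightarrow> node_set t = C \<and> branching F t"

definition valid_ineq :: "real vec \<Rightarrow> real \<Rightarrow> real vec set \<Rightarrow> bool" where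
  "valid_ineq c \<gamma> S \<longleftrightarrow> (\<forall>x\<in>S. c \<bullet> x \<le> \<gamma>)"

definition certifies :: "bb_tree \<Rightarrow> real vec \<Rightarrow> real \<Rightarrow> bool" where
  "certifies t c \<gamma> \<longleftrightarrow> (\<forall>L \<in> leaf_sets t. valid_ineq c \<gamma> L)"

definition optimal_value :: "real vec \<Rightarrow> real vec set \<Rightarrow> real \<Rightarrow> bool" where
  "optimal_value c S v \<longleftrightarrow> (\<exists>x\<in>S. c \<bullet> x = v) \<and> valid_ineq c v S"

definition all_ones :: "nat \<Rightarrow> real vec" where
  "all_ones n = vec n (\<lambda>_. 1)"

definition halfspace_H :: "nat \<Rightarrow> real vec set" where
  "halfspace_H n = {x \<in> carrier_vec n. 2 * (\<Sum>i<n. x $ i) \<le> real n}"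

definition unit_cube :: "nat \<Rightarrow> real vec set" where
  "unit_cube n = {x \<in> carrier_vec n. \<forall>i<n. 0 \<le> x $ i \<and> x $ i \<le> 1}"

definition relaxation_C :: "nat \<Rightarrow> real vec set" where
  "relaxation_C n = halfspace_H n \<inter> unit_cube n"

end

theory Submission
  imports Defs
begin

text \<open>
  Write \<open>n = 2 * m + 1\<close>. A point of the relaxation with one coordinate \<open>1/2\<close>, \<open>m\<close> coordinates
  \<open>1\<close> and the others \<open>0\<close> violates the target inequality, so it lies in no leaf and hence strictly
  between the two halves of some split used in the tree. For a split with exactly \<open>k\<close> nonzero
  coefficients, the index of the coordinate \<open>1/2\<close> must be one of these \<open>k\<close>. Once it is chosen, the
  pattern of ones on the remaining \<open>k - 1\<close> nonzero coefficients satisfies a linear equation, which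
  by the Littlewood--Offord inequality leaves at most \<open>(k - 1) choose ((k - 1) div 2)\<close> patterns,
  and each of them extends to the other coordinates in at most \<open>(n - k) choose ((n - k) div 2)\<close>
  ways. Comparing with the total number \<open>n * (2 * m choose m)\<close> of such points bounds the number
  of splits.
\<close>

section \<open>The Littlewood--Offord inequality\<close>

text \<open>The sum of the \<open>r\<close> largest binomial coefficients of row \<open>k\<close> (padded by zeros if \<open>r > k + 1\<close>).\<close>

definition middle_binomial_sum :: "nat \<Rightarrow> nat \<Rightarrow> nat" where
  "middle_binomial_sum k r = (\<Sum>i | k < 2 * i + r \<and> 2 * i \<le> k + r. k choose i)"

text \<open>Pascal's rule turns the index window in row \<open>Suc k\<close> into two windows in row
  \<open>k\<close>, shifted against each other by one. Their union is the window for
  \<open>r + 2\<close> and their intersection the window for \<open>r\<close>.\<close>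

lemma middle_binomial_sum_Suc:
  "middle_binomial_sum (Suc k) (Suc r) = middle_binomial_sum k (Suc (Suc r)) + middle_binomial_sum k r"
proof -
  \<comment> \<open>A bound beyond all windows involved, so that the sums can share one index
    range.\<close>
  define M where "M = k + r + 5"
  have mbs: "middle_binomial_sum k' r' =
      (\<Sum>i\<le>M'. if k' < 2 * i + r' \<and> 2 * i \<le> k' + r' then k' choose i else 0)"
    if "k' + r' \<le> M'" for k' r' M'
    unfolding middle_binomial_sum_def
    by (rule sum.mono_neutral_cong_left) (use that in auto)
  have "middle_binomial_sum (Suc k) (Suc r) =
      (\<Sum>i\<le>Suc M. if Suc k < 2 * i + Suc r \<and> 2 * i \<le> Suc k + Suc r then Suc k choose i else 0)"
    by (rule mbs) (simp add: M_def)
  also have "\<dots> = (\<Sum>i\<le>Suc M. if k < 2 * i + r \<and> 2 * i \<le> k + r + 2 then k choose i else 0)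
      + (\<Sum>i\<le>M. if k < 2 * i + r + 2 \<and> 2 * i \<le> k + r then k choose i else 0)"
    by (subst (1 2) sum.atMost_Suc_shift) (auto simp flip: sum.distrib intro!: sum.cong)
  also have "(\<Sum>i\<le>Suc M. if k < 2 * i + r \<and> 2 * i \<le> k + r + 2 then k choose i else 0)
      = (\<Sum>i\<le>M. if k < 2 * i + r \<and> 2 * i \<le> k + r + 2 then k choose i else 0)"
    by (subst sum.atMost_Suc) (simp add: M_def)
  also have "\<dots> + (\<Sum>i\<le>M. if k < 2 * i + r + 2 \<and> 2 * i \<le> k + r then k choose i else 0)
      = middle_binomial_sum k (Suc (Suc r)) + middle_binomial_sum k r"
    by (subst (1 2) mbs[where M' = M]) (auto simp: M_def simp flip: sum.distrib intro!: sum.cong)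
  finally show ?thesis .
qed

lemma middle_binomial_sum_1: "middle_binomial_sum k 1 \<le> k choose (k div 2)"
proof -
  \<comment> \<open>For odd \<open>k\<close> the half-open window picks the upper of the two middle
    indices, hence the appeal to \<open>binomial_maximum\<close>.\<close>
  have "{i. k < 2 * i + 1 \<and> 2 * i \<le> k + 1} = {(k + 1) div 2}" by auto
  then show ?thesis by (simp add: middle_binomial_sum_def binomial_maximum del: One_nat_def)
qed

text \<open>Sort the sets by membership of \<open>j\<close>; deleting \<open>j\<close> from those
  that contain it shifts the target values by \<open>- a j\<close>.\<close>

lemma card_subset_sums_insert:
  fixes a :: "'i \<Rightarrow> 'b::ab_group_add"
  assumes "finite S" "j \<notin> S"
  shows "card {T. T \<subseteq> insert j S \<and> sum a T \<in> V} =
    card {T. T \<subseteq> S \<and> sum a T \<in> V} + card {T. T \<subseteq> S \<and> sum a T \<in> (\<lambda>v. v - a j) ` V}"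
proof -
  let ?A = "{T. T \<subseteq> S \<and> sum a T \<in> V}" and ?B = "{T. T \<subseteq> S \<and> sum a T + a j \<in> V}"
  have sum_j: "sum a (insert j T) = sum a T + a j" if "T \<subseteq> S" for T
    using that assms by (subst sum.insert) (auto dest: finite_subset simp: add.commute)
  have "{T. T \<subseteq> insert j S \<and> sum a T \<in> V} = ?A \<union> insert j ` ?B"
  proof (intro equalityI subsetI)
    fix T assume T: "T \<in> {T. T \<subseteq> insert j S \<and> sum a T \<in> V}"
    show "T \<in> ?A \<union> insert j ` ?B"
    proof (cases "j \<in> T")
      case True
      then have "T = insert j (T - {j})" "T - {j} \<subseteq> S" using T by auto
      moreover from this have "sum a (T - {j}) + a j \<in> V" using T sum_j by (metis mem_Collect_eq)
      ultimately show ?thesis by blast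
    qed (use T in auto)
  qed (use sum_j in auto)
  moreover have "?A \<inter> insert j ` ?B = {}" using assms by auto
  moreover have "inj_on (insert j) ?B" using assms by (auto simp: inj_on_def)
  moreover have "?B = {T. T \<subseteq> S \<and> sum a T \<in> (\<lambda>v. v - a j) ` V}"
    by (auto simp: image_iff eq_diff_eq)
  ultimately show ?thesis
    using assms by (simp add: card_Un_disjoint card_image)
qed

text \<open>
  Allowing a set of target values makes the induction work: adding an element \<open>j\<close> replaces \<open>V\<close> by
  \<open>V\<close> and its translate by \<open>- a j\<close>. These differ, so an element can be moved from one to the other,
  and the recursion becomes Pascal's rule for the sums of middle binomial coefficients.
\<close>

lemma card_subset_sums_le:
  fixes a :: "'i \<Rightarrow> 'b::linordered_ab_group_add"
  assumes "finite S" "\<forall>j\<in>S. a j \<noteq> 0" "finite V"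
  shows "card {T. T \<subseteq> S \<and> sum a T \<in> V} \<le> middle_binomial_sum (card S) (card V)"
  using assms
proof (induction S arbitrary: V rule: finite_induct)
  case empty
  show ?case
  proof (cases "V = {}")
    case False
    \<comment> \<open>The empty set is the only candidate, and index \<open>0\<close> lies in the
      window because \<open>card V > 0\<close>.\<close>
    then have "(\<Sum>i\<in>{0::nat}. 0 choose i) \<le> middle_binomial_sum 0 (card V)"
      unfolding middle_binomial_sum_def using empty
      by (intro sum_mono2) (auto intro: finite_subset[of _ "{..card V}"] simp: card_gt_0_iff)
    moreover have "card {T. T \<subseteq> {} \<and> sum a T \<in> V} \<le> card {{} :: 'i set}"
      by (intro card_mono) auto
    ultimately show ?thesis by simp
  qed simp
next
  case (insert j S)
  let ?N = "\<lambda>V. card {T. T \<subseteq> S \<and> sum a T \<in> V}"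
  show ?case
  proof (cases "V = {}")
    case False
    define V' where "V' = (\<lambda>v. v - a j) ` V"
    have fin: "finite V" "finite V'" and card_V': "card V' = card V"
      using insert.prems by (auto simp: V'_def card_image inj_on_def)
    obtain v where v: "v \<in> V" "v \<notin> V'"
    proof -
      \<comment> \<open>A downward translate of \<open>V\<close> misses \<open>Max V\<close>, an
        upward one misses \<open>Min V\<close>.\<close>
      have "\<exists>v\<in>V. v \<notin> V'"
      proof (cases "a j > 0")
        case True
        have "Max V \<notin> V'"
        proof
          assume "Max V \<in> V'"
          then obtain w where "w \<in> V" "Max V = w - a j" by (auto simp: V'_def)
          moreover have "w \<le> Max V" using \<open>w \<in> V\<close> fin by simp
          ultimately show False using True by simp
        qed
        then show ?thesis using False fin Max_in by blast
      next
        case neg: False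
        have "Min V \<notin> V'"
        proof
          assume "Min V \<in> V'"
          then obtain w where "w \<in> V" "Min V = w - a j" by (auto simp: V'_def)
          moreover have "Min V \<le> w" using \<open>w \<in> V\<close> fin by simp
          ultimately show False using neg insert.prems by (simp add: not_less)
        qed
        then show ?thesis using False fin Min_in by blast
      qed
      then show ?thesis using that by blast
    qed
    have fS: "finite {T. T \<subseteq> S \<and> P T}" for P using insert.hyps by simp
    have "?N V = ?N (V - {v}) + ?N {v}"
      using v fS by (subst card_Un_disjoint[symmetric]) (auto intro: arg_cong[where f = card])
    moreover have "?N (insert v V') = ?N V' + ?N {v}"
      using v fS by (subst card_Un_disjoint[symmetric]) (auto intro: arg_cong[where f = card])
    \<comment> \<open>Moving \<open>v\<close> into \<open>V'\<close> keeps the total but changes the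
      sizes to \<open>card V + 1\<close> and \<open>card V - 1\<close>, which match the two terms of
      \<open>middle_binomial_sum_Suc\<close>.\<close>
    ultimately have "?N V + ?N V' = ?N (insert v V') + ?N (V - {v})" by simp
    also have "\<dots> \<le> middle_binomial_sum (card S) (card (insert v V'))
        + middle_binomial_sum (card S) (card (V - {v}))"
      using insert.prems fin by (intro add_mono insert.IH) auto
    also have "\<dots> = middle_binomial_sum (card (insert j S)) (card V)"
    proof -
      have "Suc (card V - 1) = card V" using card_gt_0_iff[of V] v fin by fastforce
      then show ?thesis
        using insert.hyps v fin card_V' middle_binomial_sum_Suc[of "card S" "card V - 1"] by simp
    qed
    finally show ?thesis
      using card_subset_sums_insert[OF insert.hyps, of a V] by (simp add: V'_def)
  qed simp
qed

corollary littlewood_offord: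
  fixes a :: "'i \<Rightarrow> 'b::linordered_ab_group_add"
  assumes "finite S" "\<forall>j\<in>S. a j \<noteq> 0"
  shows "card {T. T \<subseteq> S \<and> sum a T = c} \<le> card S choose (card S div 2)"
  using card_subset_sums_le[OF assms, of "{c}"] middle_binomial_sum_1[of "card S"] by simp

section \<open>Central binomial coefficients\<close>

text \<open>This growth ratio drives the inductions for both bounds below. It is obtained through
  row \<open>2 * m + 1\<close>, whose two middle entries coincide.\<close>

lemma central_binomial_Suc:
  "(m + 1) * (2 * Suc m choose Suc m) = 2 * (2 * m + 1) * (2 * m choose m)"
proof -
  have "Suc m * (Suc (2 * m + 1) choose Suc m) = Suc (2 * m + 1) * (2 * m + 1 choose m)"
    by (subst Suc_times_binomial_eq) (rule mult.commute)
  moreover have "(2 * m + 1 choose m) = (2 * m + 1 choose Suc m)"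
    using binomial_symmetric[of m "2 * m + 1"] by simp
  moreover have "Suc m * (2 * m + 1 choose Suc m) = (2 * m + 1) * (2 * m choose m)"
    using Suc_times_binomial_eq[of "2 * m" m] by (simp add: mult.commute del: binomial_Suc_Suc)
  ultimately show ?thesis
    by (simp add: algebra_simps del: binomial_Suc_Suc)
qed

text \<open>From \<open>m\<close> to \<open>m + 1\<close> the quotient of left by right side is
  multiplied by \<open>(2 * m + 1) * (2 * m + 3) / (2 * m + 2)^2\<close>, which is below 1.\<close>

lemma central_binomial_square_le: "(2 * m + 1) * (2 * m choose m)\<^sup>2 \<le> 16 ^ m"
proof (induction m)
  case (Suc m)
  define c where "c = (2 * m choose m)"
  define d where "d = (2 * Suc m choose Suc m)"
  have d: "(m + 1) * d = 2 * (2 * m + 1) * c"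
    unfolding c_def d_def by (rule central_binomial_Suc)
  have "(m + 1)\<^sup>2 * ((2 * Suc m + 1) * d\<^sup>2) = (2 * m + 3) * ((m + 1) * d)\<^sup>2"
    by (simp add: power2_eq_square algebra_simps)
  also have "\<dots> = 4 * ((2 * m + 3) * (2 * m + 1)) * ((2 * m + 1) * c\<^sup>2)"
    unfolding d by (simp add: power2_eq_square algebra_simps)
  also have "\<dots> \<le> 4 * (4 * (m + 1)\<^sup>2) * 16 ^ m"
  proof (rule mult_le_mono)
    have "(2 * m + 3) * (2 * m + 1) \<le> 4 * (m + 1)\<^sup>2" by (simp add: power2_eq_square algebra_simps)
    then show "4 * ((2 * m + 3) * (2 * m + 1)) \<le> 4 * (4 * (m + 1)\<^sup>2)" by (rule mult_le_mono2)
  qed (use Suc in \<open>simp add: c_def\<close>)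
  also have "\<dots> = (m + 1)\<^sup>2 * 16 ^ Suc m" by simp
  finally show ?case unfolding d_def by (subst (asm) mult_le_cancel1) simp
qed simp

text \<open>Equality holds at \<open>m = 1\<close>; afterwards the quotient of right by left side
  grows by the factor \<open>(2 * m + 1)^2 / (4 * m * (m + 1))\<close>.\<close>

lemma central_binomial_square_ge:
  assumes "m \<ge> 1"
  shows "16 ^ m \<le> 4 * m * (2 * m choose m)\<^sup>2"
  using assms
proof (induction m rule: dec_induct)
  case (step m)
  define c where "c = (2 * m choose m)"
  define d where "d = (2 * Suc m choose Suc m)"
  have d: "(m + 1) * d = 2 * (2 * m + 1) * c"
    unfolding c_def d_def by (rule central_binomial_Suc)
  have "(m + 1) * 16 ^ Suc m \<le> (m + 1) * (16 * (4 * m * c\<^sup>2))"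
    using step.IH unfolding c_def power_Suc by (intro mult_le_mono) auto
  also have "\<dots> = 16 * (4 * m * (m + 1)) * c\<^sup>2" by (simp add: algebra_simps)
  also have "\<dots> \<le> 16 * (2 * m + 1)\<^sup>2 * c\<^sup>2"
    by (intro mult_le_mono) (auto simp: power2_eq_square algebra_simps)
  also have "\<dots> = 4 * ((m + 1) * d)\<^sup>2"
    unfolding d by (simp add: power2_eq_square algebra_simps)
  also have "\<dots> = (m + 1) * (4 * Suc m * d\<^sup>2)" by (simp add: power2_eq_square algebra_simps)
  finally show ?case unfolding d_def by (subst (asm) mult_le_cancel1) simp
qed simp

text \<open>Odd rows reduce to even ones: the middle entry of row \<open>2 * m + 1\<close> is half
  the central entry of row \<open>2 * m + 2\<close>.\<close>

lemma middle_binomial_square_le: "(k + 1) * (k choose (k div 2))\<^sup>2 \<le> 4 ^ k"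
proof (cases "even k")
  case True
  then obtain m where "k = 2 * m" by blast
  then show ?thesis using central_binomial_square_le[of m] by (simp add: power_mult)
next
  case False
  then obtain m where k: "k = 2 * m + 1" by (auto elim: oddE)
  have "(2 * m + 1 choose m) = (2 * m + 1 choose Suc m)"
    using binomial_symmetric[of m "2 * m + 1"] by simp
  then have "(2 * Suc m choose Suc m) = 2 * (2 * m + 1 choose m)"
    by (simp del: binomial_Suc_Suc add: binomial_Suc_Suc[of "Suc (2 * m)" m])
  then have "4 * ((2 * m + 3) * (2 * m + 1 choose m)\<^sup>2) \<le> 16 * 16 ^ m"
    using central_binomial_square_le[of "Suc m"]
    by (simp add: power_mult_distrib algebra_simps del: binomial_Suc_Suc)
  then have "(2 * m + 3) * (2 * m + 1 choose m)\<^sup>2 \<le> 4 * 16 ^ m" by simp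
  moreover have "(2 * m + 2) * (2 * m + 1 choose m)\<^sup>2 \<le> (2 * m + 3) * (2 * m + 1 choose m)\<^sup>2"
    by (intro mult_le_mono) auto
  ultimately have "(2 * m + 2) * (2 * m + 1 choose m)\<^sup>2 \<le> 4 * 16 ^ m" by (rule le_trans[rotated])
  then show ?thesis by (simp add: k power_mult del: binomial_Suc_Suc)
qed

section \<open>Fractional points cut off by one split\<close>

text \<open>The pair \<open>(i, A)\<close> stands for the midpoint of the cube edge joining \<open>A\<close> and \<open>insert i A\<close>.\<close>

definition middle_edges :: "nat \<Rightarrow> nat \<Rightarrow> (nat \<times> nat set) set" where
  "middle_edges n m = (SIGMA i:{..<n}. {A. A \<subseteq> {..<n} - {i} \<and> card A = m})"

definition midpoint_vec :: "nat \<Rightarrow> nat \<times> nat set \<Rightarrow> real vec" where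
  "midpoint_vec n e = vec n (\<lambda>j. if j = fst e then 1 / 2 else if j \<in> snd e then 1 else 0)"

lemma finite_middle_edges: "finite (middle_edges n m)"
  unfolding middle_edges_def by (intro finite_SigmaI) auto

lemma card_middle_edges: "card (middle_edges n m) = n * (n - 1 choose m)"
  unfolding middle_edges_def by (subst card_SigmaI) (auto simp: n_subsets)

lemma scalar_prod_midpoint_vec:
  assumes "c \<in> carrier_vec n" "(i, A) \<in> middle_edges n m"
  shows "c \<bullet> midpoint_vec n (i, A) = c $ i / 2 + (\<Sum>j\<in>A. c $ j)"
proof -
  have iA: "i < n" "A \<subseteq> {..<n} - {i}" using assms by (auto simp: middle_edges_def)
  then have "finite A" "i \<notin> A" "insert i A \<subseteq> {..<n}" by (auto dest: finite_subset)
  have "c \<bullet> midpoint_vec n (i, A) = (\<Sum>j<n. c $ j * (if j = i then 1 / 2 else if j \<in> A then 1 else 0))"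
    by (auto simp: scalar_prod_def midpoint_vec_def lessThan_atLeast0 intro!: sum.cong)
  also have "\<dots> = (\<Sum>j\<in>insert i A. c $ j * (if j = i then 1 / 2 else if j \<in> A then 1 else 0))"
    using \<open>insert i A \<subseteq> {..<n}\<close> by (intro sum.mono_neutral_right) auto
  also have "\<dots> = c $ i / 2 + (\<Sum>j\<in>A. c $ j * (if j = i then 1 / 2 else if j \<in> A then 1 else 0))"
    using \<open>finite A\<close> \<open>i \<notin> A\<close> by simp
  also have "(\<Sum>j\<in>A. c $ j * (if j = i then 1 / 2 else if j \<in> A then 1 else 0)) = (\<Sum>j\<in>A. c $ j)"
    using \<open>i \<notin> A\<close> by (intro sum.cong) auto
  finally show ?thesis .
qed

text \<open>The coordinate sum \<open>m + 1 / 2\<close> is exactly half the dimension, so the point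
  lies on the boundary of the halfspace while exceeding the target bound \<open>m\<close>.\<close>

lemma midpoint_vec_in_relaxation:
  assumes "e \<in> middle_edges (2 * m + 1) m"
  shows "midpoint_vec (2 * m + 1) e \<in> relaxation_C (2 * m + 1)"
    and "all_ones (2 * m + 1) \<bullet> midpoint_vec (2 * m + 1) e = real m + 1 / 2"
proof -
  obtain i A where e: "e = (i, A)" by fastforce
  have iA: "i < 2 * m + 1" "A \<subseteq> {..<2 * m + 1}" "card A = m"
    using assms by (auto simp: middle_edges_def e)
  have "all_ones (2 * m + 1) \<bullet> midpoint_vec (2 * m + 1) e
      = all_ones (2 * m + 1) $ i / 2 + (\<Sum>j\<in>A. all_ones (2 * m + 1) $ j)"
    unfolding e by (rule scalar_prod_midpoint_vec[where m = m]) (use assms e in \<open>auto simp: all_ones_def\<close>)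
  also have "(\<Sum>j\<in>A. all_ones (2 * m + 1) $ j) = (\<Sum>j\<in>A. 1)"
    using iA by (intro sum.cong) (auto simp: all_ones_def)
  finally show eq: "all_ones (2 * m + 1) \<bullet> midpoint_vec (2 * m + 1) e = real m + 1 / 2"
    using iA by (simp add: all_ones_def)
  have "all_ones (2 * m + 1) \<bullet> midpoint_vec (2 * m + 1) e
      = (\<Sum>j<2 * m + 1. midpoint_vec (2 * m + 1) e $ j)"
    by (auto simp: scalar_prod_def all_ones_def midpoint_vec_def lessThan_atLeast0 intro!: sum.cong)
  then show "midpoint_vec (2 * m + 1) e \<in> relaxation_C (2 * m + 1)"
    unfolding eq relaxation_C_def halfspace_H_def unit_cube_def by (auto simp: midpoint_vec_def)
qed

text \<open>Within \<open>carrier_vec n\<close> these are the points that branching on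
  \<open>split_disj n p p0\<close> discards.\<close>

definition strictly_between :: "int vec \<Rightarrow> int \<Rightarrow> real vec set" where
  "strictly_between p p0 = {x. real_of_int p0 < real_vec p \<bullet> x \<and> real_vec p \<bullet> x < real_of_int p0 + 1}"

text \<open>The equation amounts to \<open>sum p (A \<inter> K) = c\<close>. Littlewood--Offord on
  \<open>K - {i}\<close> bounds the choices of \<open>A \<inter> K\<close>; the size of
  \<open>A - K\<close> is then fixed, so a middle binomial bounds its choices.\<close>

lemma card_slice_le:
  fixes p :: "nat \<Rightarrow> int"
  assumes K: "K \<subseteq> {..<n}" "\<forall>j\<in>K. p j \<noteq> 0" and i: "i \<in> K"
  shows "card {A. A \<subseteq> {..<n} - {i} \<and> card A = m \<and> sum p A = c + sum p (A - K)}
    \<le> (card K - 1 choose ((card K - 1) div 2)) * (n - card K choose ((n - card K) div 2))"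
proof -
  have fin: "finite K" using K finite_subset by blast
  let ?L = "{T. T \<subseteq> K - {i} \<and> sum p T = c}"
  \<comment> \<open>Sets \<open>T\<close> with more than \<open>m\<close> elements, where the
    subtraction truncates to 0, only enlarge \<open>?S\<close>; the bound on the fibres is uniform
    in \<open>T\<close>.\<close>
  let ?S = "SIGMA T:?L. {B. B \<subseteq> {..<n} - K \<and> card B = m - card T}"
  have finL: "finite ?L" using fin by simp
  have "card {A. A \<subseteq> {..<n} - {i} \<and> card A = m \<and> sum p A = c + sum p (A - K)} \<le> card ?S"
  proof (rule card_inj_on_le[where f = "\<lambda>A. (A \<inter> K, A - K)"])
    show "inj_on (\<lambda>A. (A \<inter> K, A - K))
        {A. A \<subseteq> {..<n} - {i} \<and> card A = m \<and> sum p A = c + sum p (A - K)}"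
      by (rule inj_onI) (metis Int_Diff_Un prod.inject)
    show "finite ?S" using finL by (intro finite_SigmaI) auto
    show "(\<lambda>A. (A \<inter> K, A - K)) ` {A. A \<subseteq> {..<n} - {i} \<and> card A = m \<and> sum p A = c + sum p (A - K)} \<subseteq> ?S"
    proof clarsimp
      fix A assume A: "A \<subseteq> {..<n} - {i}" "m = card A" "sum p A = c + sum p (A - K)"
      then have "finite A" by (auto dest: finite_subset)
      then have "sum p A = sum p (A \<inter> K) + sum p (A - K)" by (rule sum.Int_Diff)
      moreover have "card (A - K) = card A - card (A \<inter> K)"
        using \<open>finite A\<close> by (simp add: card_Diff_subset_Int)
      ultimately show "A \<inter> K \<subseteq> K - {i} \<and> sum p (A \<inter> K) = c \<and> A - K \<subseteq> {..<n} - K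
          \<and> card (A - K) = card A - card (A \<inter> K)"
        using A by auto
    qed
  qed
  also have "card ?S = (\<Sum>T\<in>?L. n - card K choose (m - card T))"
    using finL K fin by (subst card_SigmaI) (auto simp: n_subsets card_Diff_subset)
  also have "\<dots> \<le> (\<Sum>T\<in>?L. n - card K choose ((n - card K) div 2))"
    by (intro sum_mono binomial_maximum)
  also have "\<dots> = card ?L * (n - card K choose ((n - card K) div 2))" by simp
  also have "card ?L \<le> card K - 1 choose ((card K - 1) div 2)"
    using littlewood_offord[of "K - {i}" p c] fin K i by simp
  finally show ?thesis by simp
qed

text \<open>
  At a midpoint \<open>(i, A)\<close> the linear form takes half-integral values, so it lies strictly inside a
  split only if the value is \<open>p0 + 1 / 2\<close>; this forces \<open>p $ i\<close> to be odd, hence nonzero.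
\<close>

lemma midpoint_strictly_between:
  assumes p: "p \<in> carrier_vec n" and e: "(i, A) \<in> middle_edges n m"
    and btw: "midpoint_vec n (i, A) \<in> strictly_between p p0"
  shows "p $ i \<noteq> 0" "(\<Sum>j\<in>A. p $ j) = (2 * p0 + 1 - p $ i) div 2"
proof -
  have iA: "i < n" "A \<subseteq> {..<n}" using e by (auto simp: middle_edges_def)
  have "real_vec p \<bullet> midpoint_vec n (i, A) = real_vec p $ i / 2 + (\<Sum>j\<in>A. real_vec p $ j)"
    by (rule scalar_prod_midpoint_vec[OF _ e]) (use p in \<open>auto simp: real_vec_def\<close>)
  also have "\<dots> = real_of_int (p $ i) / 2 + real_of_int (\<Sum>j\<in>A. p $ j)"
    using p iA by (auto simp: real_vec_def intro!: sum.cong)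
  finally have val: "real_vec p \<bullet> midpoint_vec n (i, A) = \<dots>" .
  have "2 * p0 < p $ i + 2 * (\<Sum>j\<in>A. p $ j)" "p $ i + 2 * (\<Sum>j\<in>A. p $ j) < 2 * p0 + 2"
    using btw unfolding strictly_between_def mem_Collect_eq val by linarith+
  then have "p $ i = 2 * p0 + 1 - 2 * (\<Sum>j\<in>A. p $ j)" by linarith
  then show "p $ i \<noteq> 0" "(\<Sum>j\<in>A. p $ j) = (2 * p0 + 1 - p $ i) div 2" by presburger+
qed

text \<open>Slice by the half-integral coordinate \<open>i\<close>, which must lie in the support of
  \<open>p\<close>. As \<open>p\<close> vanishes off its support, each slice has the form counted in
  \<open>card_slice_le\<close>.\<close>

lemma card_cut_midpoints_le:
  assumes p: "p \<in> carrier_vec n" and k: "k = card {i. i < n \<and> p $ i \<noteq> 0}"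
  shows "card {e \<in> middle_edges n m. midpoint_vec n e \<in> strictly_between p p0}
    \<le> k * ((k - 1 choose ((k - 1) div 2)) * (n - k choose ((n - k) div 2)))"
proof -
  define K where "K = {i. i < n \<and> p $ i \<noteq> 0}"
  have K: "K \<subseteq> {..<n}" "\<forall>j\<in>K. p $ j \<noteq> 0" "finite K" "k = card K" by (auto simp: K_def k)
  let ?c = "\<lambda>i. (2 * p0 + 1 - p $ i) div 2"
  let ?F = "\<lambda>i. {A. A \<subseteq> {..<n} - {i} \<and> card A = m \<and>
      (\<Sum>j\<in>A. p $ j) = ?c i + (\<Sum>j\<in>A - K. p $ j)}"
  have "{e \<in> middle_edges n m. midpoint_vec n e \<in> strictly_between p p0} \<subseteq> (SIGMA i:K. ?F i)"
  proof clarify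
    fix i A
    assume e: "(i, A) \<in> middle_edges n m" and btw: "midpoint_vec n (i, A) \<in> strictly_between p p0"
    have iA: "i < n" "A \<subseteq> {..<n} - {i}" "card A = m" using e by (auto simp: middle_edges_def)
    then have "(\<Sum>j\<in>A - K. p $ j) = 0" by (intro sum.neutral) (auto simp: K_def)
    then show "i \<in> K \<and> A \<in> ?F i"
      using iA midpoint_strictly_between[OF p e btw] by (simp add: K_def)
  qed
  then have "card {e \<in> middle_edges n m. midpoint_vec n e \<in> strictly_between p p0} \<le> card (SIGMA i:K. ?F i)"
    using K by (intro card_mono finite_SigmaI) auto
  also have "\<dots> = (\<Sum>i\<in>K. card (?F i))" using K by (intro card_SigmaI) auto
  also have "\<dots> \<le> (\<Sum>i\<in>K. (k - 1 choose ((k - 1) div 2)) * (n - k choose ((n - k) div 2)))"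
    unfolding K(4) using K by (intro sum_mono card_slice_le) auto
  finally show ?thesis using K by simp
qed

text \<open>Squaring keeps the estimate in the naturals: \<open>middle_binomial_square_le\<close>
  for rows \<open>k - 1\<close> and \<open>2 * m + 1 - k\<close> multiplies to
  \<open>4 ^ (2 * m)\<close>, and one factor \<open>k \<le> s\<close> is left over.\<close>

lemma card_cut_midpoints_square_le:
  assumes p: "p \<in> carrier_vec (2 * m + 1)" and s: "card {i. i < 2 * m + 1 \<and> p $ i \<noteq> 0} \<le> s"
  shows "(card {e \<in> middle_edges (2 * m + 1) m. midpoint_vec (2 * m + 1) e \<in> strictly_between p p0})\<^sup>2
      * (2 * m + 1 - s) \<le> s * 16 ^ m"
proof -
  define k where "k = card {i. i < 2 * m + 1 \<and> p $ i \<noteq> 0}"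
  define a where "a = (k - 1 choose ((k - 1) div 2))"
  define b where "b = (2 * m + 1 - k choose ((2 * m + 1 - k) div 2))"
  define x where "x = card {e \<in> middle_edges (2 * m + 1) m.
    midpoint_vec (2 * m + 1) e \<in> strictly_between p p0}"
  have x: "x \<le> k * (a * b)"
    unfolding x_def a_def b_def by (rule card_cut_midpoints_le[OF p k_def])
  have "card {i. i < 2 * m + 1 \<and> p $ i \<noteq> 0} \<le> card {..<2 * m + 1}" by (intro card_mono) auto
  then have k_le: "k \<le> 2 * m + 1" by (simp add: k_def)
  show ?thesis
  proof (cases "k = 0")
    case False
    have "x\<^sup>2 * (2 * m + 1 - s) \<le> (k * (a * b))\<^sup>2 * (2 * m + 1 - k + 1)"
      using x s by (intro mult_le_mono power_mono) (auto simp: k_def)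
    \<comment> \<open>One of the two factors \<open>k\<close> is absorbed by \<open>a\<close>;
      writing it as \<open>k - 1 + 1\<close> relies on \<open>k \<noteq> 0\<close>.\<close>
    also have "\<dots> = k * (((k - 1 + 1) * a\<^sup>2) * ((2 * m + 1 - k + 1) * b\<^sup>2))"
      using False by (simp add: power2_eq_square algebra_simps)
    also have "\<dots> \<le> s * (4 ^ (k - 1) * 4 ^ (2 * m + 1 - k))"
      unfolding a_def b_def using s
      by (intro mult_le_mono middle_binomial_square_le) (simp add: k_def)
    also have "(4::nat) ^ (k - 1) * 4 ^ (2 * m + 1 - k) = 16 ^ m"
      using False k_le by (simp add: power_mult flip: power_add)
    finally show ?thesis by (simp add: x_def)
  qed (use x in \<open>simp add: x_def\<close>)
qed

section \<open>Trees\<close>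

text \<open>\<open>P\<close> collects the splits applied at inner nodes. A point followed down from
  the root either reaches a leaf or is lost at some split, lying strictly between its halves. The
  restriction to \<open>carrier_vec n\<close> matters because the halves contain only such
  vectors.\<close>

lemma branching_splits_used:
  assumes "branching (sparse_splits n s) t"
  shows "\<exists>P. finite P \<and> card P \<le> num_nodes t \<and>
    (\<forall>(p, p0)\<in>P. p \<in> carrier_vec n \<and> card {i. i < n \<and> p $ i \<noteq> 0} \<le> s) \<and>
    node_set t \<inter> carrier_vec n \<subseteq> \<Union> (leaf_sets t) \<union> (\<Union>(p, p0)\<in>P. strictly_between p p0)"
  using assms
proof (induction rule: branching.induct)
  case (leaf N)
  show ?case by (rule exI[of _ "{}"]) auto
next
  case (branch Qs ts N)
  obtain p p0 where p: "p \<in> carrier_vec n" "card {i. i < n \<and> p $ i \<noteq> 0} \<le> s"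
    and Qs: "Qs = split_disj n p p0"
    using branch.hyps(1) by (auto simp: sparse_splits_def)
  have "map node_set ts = map (\<lambda>Q. Q \<inter> N) (split_disj n p p0)"
    using branch.hyps(2) Qs by simp
  then obtain t1 t2 where ts: "ts = [t1, t2]"
    and t1: "node_set t1 = {x \<in> carrier_vec n. real_vec p \<bullet> x \<le> real_of_int p0} \<inter> N"
    and t2: "node_set t2 = {x \<in> carrier_vec n. real_vec p \<bullet> x \<ge> real_of_int p0 + 1} \<inter> N"
    by (auto simp: split_disj_def map_eq_Cons_conv)
  obtain P1 where P1: "finite P1" "card P1 \<le> num_nodes t1"
    "\<forall>(p, p0)\<in>P1. p \<in> carrier_vec n \<and> card {i. i < n \<and> p $ i \<noteq> 0} \<le> s"
    "node_set t1 \<inter> carrier_vec n \<subseteq> \<Union> (leaf_sets t1) \<union> (\<Union>(p, p0)\<in>P1. strictly_between p p0)"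
    using branch.IH ts by auto
  obtain P2 where P2: "finite P2" "card P2 \<le> num_nodes t2"
    "\<forall>(p, p0)\<in>P2. p \<in> carrier_vec n \<and> card {i. i < n \<and> p $ i \<noteq> 0} \<le> s"
    "node_set t2 \<inter> carrier_vec n \<subseteq> \<Union> (leaf_sets t2) \<union> (\<Union>(p, p0)\<in>P2. strictly_between p p0)"
    using branch.IH ts by auto
  let ?P = "insert (p, p0) (P1 \<union> P2)"
  have "N \<inter> carrier_vec n \<subseteq> node_set t1 \<union> node_set t2 \<union> strictly_between p p0"
    unfolding t1 t2 strictly_between_def by auto
  then have "N \<inter> carrier_vec n
      \<subseteq> (node_set t1 \<inter> carrier_vec n) \<union> (node_set t2 \<inter> carrier_vec n) \<union> strictly_between p p0"
    by blast
  also have "\<dots> \<subseteq> (\<Union> (leaf_sets t1) \<union> (\<Union>(p, p0)\<in>P1. strictly_between p p0))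
      \<union> (\<Union> (leaf_sets t2) \<union> (\<Union>(p, p0)\<in>P2. strictly_between p p0)) \<union> strictly_between p p0"
    by (intro Un_mono P1(4) P2(4) order_refl)
  also have "\<dots> = \<Union> (leaf_sets (Node N ts)) \<union> (\<Union>(p, p0)\<in>?P. strictly_between p p0)"
    unfolding ts by (simp add: Un_ac)
  finally have "N \<inter> carrier_vec n
      \<subseteq> \<Union> (leaf_sets (Node N ts)) \<union> (\<Union>(p, p0)\<in>?P. strictly_between p p0)" .
  moreover have "card ?P \<le> num_nodes (Node N ts)"
    using card_Un_le[of P1 P2] P1(1,2) P2(1,2) by (simp add: card_insert_if ts)
  moreover have "finite ?P" "\<forall>(p, p0)\<in>?P. p \<in> carrier_vec n \<and> card {i. i < n \<and> p $ i \<noteq> 0} \<le> s"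
    using P1(1,3) P2(1,3) p by auto
  ultimately show ?case by (intro exI[of _ ?P]) simp
qed

section \<open>The optimal value and the lower bound\<close>

lemma floor_half_odd: "\<lfloor>real (2 * m + 1) / 2\<rfloor> = int m"
  by (rule floor_unique) auto

lemma optimal_value_relaxation:
  fixes m :: nat
  defines "n \<equiv> 2 * m + 1"
  shows "optimal_value (all_ones n) (relaxation_C n \<inter> int_points n) (real m)"
proof -
  have ones: "all_ones n \<bullet> x = (\<Sum>i<n. x $ i)" if "x \<in> carrier_vec n" for x
    using that by (auto simp: scalar_prod_def all_ones_def lessThan_atLeast0 intro!: sum.cong)
  let ?x = "vec n (\<lambda>i. if i < m then 1 else 0 :: real)"
  have "(\<Sum>i<n. ?x $ i) = (\<Sum>i\<in>{..<m}. 1)"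
    by (rule sum.mono_neutral_cong_right) (auto simp: n_def)
  then have sum_x: "(\<Sum>i<n. ?x $ i) = real m" by simp
  have "?x \<in> relaxation_C n \<inter> int_points n"
    using sum_x by (auto simp: relaxation_C_def halfspace_H_def unit_cube_def int_points_def n_def)
  moreover have "all_ones n \<bullet> ?x = real m" by (simp add: ones sum_x del: index_vec)
  moreover have "all_ones n \<bullet> x \<le> real m" if x: "x \<in> relaxation_C n \<inter> int_points n" for x
  proof -
    have eq: "all_ones n \<bullet> x = (\<Sum>i<n. x $ i)" using x by (intro ones) (auto simp: int_points_def)
    have "(\<Sum>i<n. x $ i) \<in> \<int>" using x by (auto simp: int_points_def)
    then obtain z where z: "(\<Sum>i<n. x $ i) = real_of_int z" by (elim Ints_cases)
    \<comment> \<open>Integrality rounds the bound \<open>z \<le> m + 1 / 2\<close> down to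
      \<open>m\<close>.\<close>
    have "2 * real_of_int z \<le> real n" using x z by (auto simp: relaxation_C_def halfspace_H_def)
    then have "z \<le> int m" unfolding n_def by linarith
    then show ?thesis unfolding eq z by linarith
  qed
  ultimately show ?thesis unfolding optimal_value_def valid_ineq_def by blast
qed

text \<open>Every midpoint is cut off by some split in \<open>P\<close>, and each split cuts off at
  most \<open>B\<close> of them; so \<open>num_nodes t * B\<close> is at least the number of
  midpoints.\<close>

lemma num_nodes_lower_bound:
  fixes m s :: nat
  defines "n \<equiv> 2 * m + 1"
  assumes s: "1 \<le> s" "s \<le> m"
    and proof_t: "bb_proof (sparse_splits n s) (relaxation_C n) t"
    and cert: "certifies t (all_ones n) (real m)"
  shows "real (num_nodes t) \<ge> 1 / 2 * sqrt (real n * (real n - real s) / real s)"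
proof -
  obtain P where P: "finite P" "card P \<le> num_nodes t"
    "\<forall>(p, p0)\<in>P. p \<in> carrier_vec n \<and> card {i. i < n \<and> p $ i \<noteq> 0} \<le> s"
    "relaxation_C n \<inter> carrier_vec n \<subseteq> \<Union> (leaf_sets t) \<union> (\<Union>(p, p0)\<in>P. strictly_between p p0)"
    using branching_splits_used[of n s t] proof_t by (auto simp: bb_proof_def)
  let ?cut = "\<lambda>(p, p0). {e \<in> middle_edges n m. midpoint_vec n e \<in> strictly_between p p0}"
  have "middle_edges n m \<subseteq> (\<Union>q\<in>P. ?cut q)"
  proof
    fix e assume e: "e \<in> middle_edges n m"
    then have e_C: "midpoint_vec n e \<in> relaxation_C n" "all_ones n \<bullet> midpoint_vec n e = real m + 1 / 2"
      using midpoint_vec_in_relaxation[of e m] by (auto simp: n_def)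
    then have "midpoint_vec n e \<notin> \<Union> (leaf_sets t)"
      using cert unfolding certifies_def valid_ineq_def by fastforce
    moreover have "midpoint_vec n e \<in> carrier_vec n" by (simp add: midpoint_vec_def)
    ultimately show "e \<in> (\<Union>q\<in>P. ?cut q)" using P(4) e e_C(1) by blast
  qed
  then have "card (middle_edges n m) \<le> card (\<Union>q\<in>P. ?cut q)"
    using P(1) by (intro card_mono finite_UN_I) (auto intro: finite_subset[OF _ finite_middle_edges])
  also have "\<dots> \<le> (\<Sum>q\<in>P. card (?cut q))" using P(1) by (rule card_UN_le)
  finally have cover: "n * (2 * m choose m) \<le> (\<Sum>q\<in>P. card (?cut q))"
    by (simp add: card_middle_edges n_def)
  \<comment> \<open>The root of the bound in \<open>card_cut_midpoints_square_le\<close>, divided by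
    \<open>n - s\<close>.\<close>
  define B where "B = sqrt (real s * 16 ^ m / real (n - s))"
  have ns: "real (n - s) = real n - real s" "real n - real s > 0" using s by (auto simp: n_def)
  have cut_le: "real (card (?cut q)) \<le> B" if "q \<in> P" for q
  proof -
    have "(card (?cut q))\<^sup>2 * (n - s) \<le> s * 16 ^ m"
      using P(3) that card_cut_midpoints_square_le[of "fst q" m s "snd q"]
      by (auto simp: n_def split: prod.splits)
    then have "real ((card (?cut q))\<^sup>2 * (n - s)) \<le> real (s * 16 ^ m)" by (rule of_nat_mono)
    then have "(real (card (?cut q)))\<^sup>2 \<le> real s * 16 ^ m / real (n - s)"
      using ns by (simp add: pos_le_divide_eq)
    then show ?thesis unfolding B_def by (rule real_le_rsqrt)
  qed
  have "real (n * (2 * m choose m)) \<le> real (\<Sum>q\<in>P. card (?cut q))" using cover by (rule of_nat_mono)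
  also have "\<dots> = (\<Sum>q\<in>P. real (card (?cut q)))" by simp
  also have "\<dots> \<le> (\<Sum>q\<in>P. B)" by (intro sum_mono cut_le)
  also have "\<dots> = real (card P) * B" by simp
  also have "\<dots> \<le> real (num_nodes t) * B"
    using P(2) by (intro mult_right_mono) (auto simp: B_def)
  finally have "(real (n * (2 * m choose m)))\<^sup>2 \<le> (real (num_nodes t) * B)\<^sup>2"
    by (intro power_mono) auto
  also have "\<dots> = (real (num_nodes t))\<^sup>2 * (real s * 16 ^ m / (real n - real s))"
    using ns by (simp add: power_mult_distrib B_def)
  finally have upper: "(real n)\<^sup>2 * (real (2 * m choose m))\<^sup>2 * (real n - real s)
      \<le> (real (num_nodes t))\<^sup>2 * real s * 16 ^ m"
    using ns by (simp add: power_mult_distrib pos_le_divide_eq mult.assoc)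
  have "real (16 ^ m) \<le> real (4 * m * (2 * m choose m)\<^sup>2)"
    using s by (intro of_nat_mono central_binomial_square_ge) auto
  also have "\<dots> \<le> 4 * real n * (real (2 * m choose m))\<^sup>2"
    by (auto simp: n_def intro!: mult_right_mono)
  \<comment> \<open>Scaling by \<open>n * (n - s)\<close> makes the right side four times the left
    side of \<open>upper\<close>. Then \<open>16 ^ m\<close> cancels, and the 4 becomes the constant
    \<open>1 / 2\<close> after taking roots.\<close>
  finally have "real n * (real n - real s) * 16 ^ m
      \<le> real n * (real n - real s) * (4 * real n * (real (2 * m choose m))\<^sup>2)"
    using ns by (intro mult_left_mono) auto
  also have "\<dots> = 4 * ((real n)\<^sup>2 * (real (2 * m choose m))\<^sup>2 * (real n - real s))"
    by (simp add: power2_eq_square)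
  also have "\<dots> \<le> (4 * (real (num_nodes t))\<^sup>2 * real s) * 16 ^ m" using upper by simp
  finally have "real n * (real n - real s) \<le> 4 * (real (num_nodes t))\<^sup>2 * real s" by simp
  then have "real n * (real n - real s) / real s \<le> (2 * real (num_nodes t))\<^sup>2"
    using s by (simp add: pos_divide_le_eq power_mult_distrib)
  then have "sqrt (real n * (real n - real s) / real s) \<le> 2 * real (num_nodes t)"
    by (intro real_le_lsqrt) auto
  then show ?thesis by simp
qed

theorem theorem1p6:
  "(\<forall>n::nat. odd n \<longrightarrow>
      optimal_value (all_ones n) (relaxation_C n \<inter> int_points n) (real_of_int \<lfloor>real n / 2\<rfloor>)) \<and>
   (\<exists>\<kappa>::real. \<kappa> > 0 \<and>
      (\<forall>(n::nat) (s::nat) (t::bb_tree).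
         odd n \<longrightarrow> 1 \<le> s \<longrightarrow> int s \<le> \<lfloor>real n / 2\<rfloor> \<longrightarrow>
         bb_proof (sparse_splits n s) (relaxation_C n) t \<longrightarrow>
         certifies t (all_ones n) (real_of_int \<lfloor>real n / 2\<rfloor>) \<longrightarrow>
         real (num_nodes t) \<ge> \<kappa> * sqrt (real n * (real n - real s) / real s)))"
proof (intro conjI allI impI exI[of _ "1 / 2 :: real"])
  fix n :: nat assume "odd n"
  then obtain m where n: "n = 2 * m + 1" by (elim oddE)
  show "optimal_value (all_ones n) (relaxation_C n \<inter> int_points n) (real_of_int \<lfloor>real n / 2\<rfloor>)"
    using optimal_value_relaxation[of m] unfolding n floor_half_odd by simp
next
  fix n s :: nat and t
  assume "odd n" and s: "1 \<le> s" "int s \<le> \<lfloor>real n / 2\<rfloor>"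
    and t: "bb_proof (sparse_splits n s) (relaxation_C n) t"
      "certifies t (all_ones n) (real_of_int \<lfloor>real n / 2\<rfloor>)"
  obtain m where n: "n = 2 * m + 1" using \<open>odd n\<close> by (elim oddE)
  show "1 / 2 * sqrt (real n * (real n - real s) / real s) \<le> real (num_nodes t)"
    using num_nodes_lower_bound[of s m t] s t unfolding n floor_half_odd by simp
qed simp

end
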